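(* Let $G=(V,E)$ be a graph and let $v\in V$. Then $v$ is avoidable in $G$ if and only if $v$ is a simplicial vertex in some minimal triangulation of $G$.
   Context: Graphs are finite, simple, undirected, with non-empty vertex set. A vertex is simplicial if its neighborhood is a clique. A vertex $v$ of a graph $G$ is avoidable if for every two distinct neighbors $x,y$ of $v$ there is an $x,y$-path in $G$ none of whose internal vertices is $v$ or a neighbor of $v$; equivalently, every induced $P_3$ (three-vertex path) having $v$ as its midpoint is contained in an induced cycle of $G$. A graph is chordal if every cycle of length at least four has a chord. A triangulation of $G=(V,E)$ is a chordal graph $H=(V,E\cup F)$, where $F$ is a set of non-edges of $G$; it is minimal if for every proper subset $F'$ of $F$ the graph $(V,E\cup F')$ is not chordal. *)

theory Defs
  imports "Graph_Theory.Graph_Theory"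
begin

text \<open>
  A finite simple undirected graph is a \<^locale>\<open>pair_graph\<close>: the undirected edge between
  \<open>x\<close> and \<open>y\<close> is represented by the two arcs \<open>(x, y)\<close> and \<open>(y, x)\<close>. Accordingly, a set of
  undirected edges or non-edges is a symmetric set of ordered pairs.
\<close>

definition nbhd :: "'a pair_pre_digraph \<Rightarrow> 'a \<Rightarrow> 'a set" where
  "nbhd G v = {u. (v, u) \<in> parcs G}"

definition clique :: "'a pair_pre_digraph \<Rightarrow> 'a set \<Rightarrow> bool" where
  "clique G K \<longleftrightarrow> K \<subseteq> pverts G \<and> (\<forall>x\<in>K. \<forall>y\<in>K. x \<noteq> y \<longrightarrow> (x, y) \<in> parcs G)"

definition simplicial :: "'a pair_pre_digraph \<Rightarrow> 'a \<Rightarrow> bool" where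
  "simplicial G v \<longleftrightarrow> v \<in> pverts G \<and> clique G (nbhd G v)"

text \<open>
  A path visits each vertex at most once, so its internal vertices are its vertices other than
  the two ends.
\<close>

definition avoidable :: "'a pair_pre_digraph \<Rightarrow> 'a \<Rightarrow> bool" where
  "avoidable G v \<longleftrightarrow> v \<in> pverts G \<and>
     (\<forall>x\<in>nbhd G v. \<forall>y\<in>nbhd G v. x \<noteq> y \<longrightarrow>
       (\<exists>p. pre_digraph.apath (with_proj G) x p y \<and>
            (set (pre_digraph.awalk_verts (with_proj G) x p) - {x, y}) \<inter> ({v} \<union> nbhd G v) = {}))"

text \<open>
  The library's \<^const>\<open>pre_digraph.cycle\<close> admits the degenerate closed walk that traverses an
  edge back and forth, but from length three on it is a cycle in the undirected sense. A cycle is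
  given by its list of arcs, each edge of it being traversed in only one direction, so a chord
  must avoid both orientations.
\<close>

definition chord :: "'a pair_pre_digraph \<Rightarrow> ('a \<times> 'a) awalk \<Rightarrow> 'a \<Rightarrow> 'a \<Rightarrow> bool" where
  "chord G c x y \<longleftrightarrow> x \<in> fst ` set c \<and> y \<in> fst ` set c \<and> (x, y) \<in> parcs G \<and>
     (x, y) \<notin> set c \<and> (y, x) \<notin> set c"

definition chordal :: "'a pair_pre_digraph \<Rightarrow> bool" where
  "chordal G \<longleftrightarrow>
     (\<forall>c. pre_digraph.cycle (with_proj G) c \<and> 4 \<le> length c \<longrightarrow> (\<exists>x y. chord G c x y))"

definition non_edges :: "'a pair_pre_digraph \<Rightarrow> ('a \<times> 'a) set" where
  "non_edges G = {(x, y). x \<in> pverts G \<and> y \<in> pverts G \<and> x \<noteq> y \<and> (x, y) \<notin> parcs G}"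

definition add_edges :: "'a pair_pre_digraph \<Rightarrow> ('a \<times> 'a) set \<Rightarrow> 'a pair_pre_digraph" where
  "add_edges G F = G\<lparr>parcs := parcs G \<union> F\<rparr>"

definition triangulation_by ::
    "'a pair_pre_digraph \<Rightarrow> ('a \<times> 'a) set \<Rightarrow> 'a pair_pre_digraph \<Rightarrow> bool" where
  "triangulation_by G F H \<longleftrightarrow>
     sym F \<and> F \<subseteq> non_edges G \<and> H = add_edges G F \<and> chordal H"

definition minimal_triangulation :: "'a pair_pre_digraph \<Rightarrow> 'a pair_pre_digraph \<Rightarrow> bool" where
  "minimal_triangulation G H \<longleftrightarrow>
     (\<exists>F. triangulation_by G F H \<and>
          (\<forall>F'. sym F' \<and> F' \<subset> F \<longrightarrow> \<not> chordal (add_edges G F')))"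

end

theory Submission
  imports Defs
begin

text \<open>
  If \<open>v\<close> is avoidable, take a triangulation \<open>H\<close> with as few fill edges as possible, for inclusion,
  among those without fill edges at \<open>v\<close>; it is a minimal triangulation. If two neighbours \<open>x, y\<close> of
  \<open>v\<close> were not adjacent in \<open>H\<close>, then a shortest \<open>x, y\<close>-path in \<open>H\<close> whose interior avoids the closed
  neighbourhood of \<open>v\<close> would form with \<open>v\<close> a chordless cycle of length at least four.

  Conversely, let \<open>v\<close> be simplicial in a minimal triangulation \<open>H\<close>, and suppose that no
  \<open>x, y\<close>-path in \<open>G\<close> avoids \<open>S = N\<^sub>H[v] - {x, y}\<close>. Since \<open>S\<close> is a clique of \<open>H\<close> that separates \<open>x\<close>
  from \<open>y\<close> in \<open>G\<close>, deleting from \<open>H\<close> all edges across this separation, among them \<open>xy\<close>, leaves a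
  chordal graph, against minimality.
\<close>

section \<open>Cycles as vertex lists and as arc lists\<close>

text \<open>
  Cycles are handled as lists of distinct vertices; \<open>vchord E vs i j\<close> says that the vertices at
  positions \<open>i < j\<close> are adjacent but not cyclically consecutive.
\<close>

definition vcycle :: "'a rel \<Rightarrow> 'a list \<Rightarrow> bool" where
  "vcycle E vs \<longleftrightarrow> distinct vs \<and> (\<forall>i. Suc i < length vs \<longrightarrow> (vs ! i, vs ! Suc i) \<in> E) \<and>
     (last vs, hd vs) \<in> E"

definition vchord :: "'a rel \<Rightarrow> 'a list \<Rightarrow> nat \<Rightarrow> nat \<Rightarrow> bool" where
  "vchord E vs i j \<longleftrightarrow> Suc i < j \<and> j < length vs \<and> (0 < i \<or> Suc j < length vs) \<and>
     (vs ! i, vs ! j) \<in> E"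

definition vchordal :: "'a rel \<Rightarrow> bool" where
  "vchordal E \<longleftrightarrow> (\<forall>vs. vcycle E vs \<and> 4 \<le> length vs \<longrightarrow> (\<exists>i j. vchord E vs i j))"

text \<open>The bridge to the library's cycles: each vertex is paired with its cyclic successor, so
  \<open>map fst\<close> recovers the vertex list.\<close>

definition cycle_arcs :: "'a list \<Rightarrow> ('a \<times> 'a) list" where
  "cycle_arcs vs = zip vs (tl vs @ [hd vs])"

lemma length_cycle_arcs: "vs \<noteq> [] \<Longrightarrow> length (cycle_arcs vs) = length vs"
  by (simp add: cycle_arcs_def)

lemma map_fst_cycle_arcs: "vs \<noteq> [] \<Longrightarrow> map fst (cycle_arcs vs) = vs"
  by (simp add: cycle_arcs_def)

lemma map_snd_cycle_arcs: "vs \<noteq> [] \<Longrightarrow> map snd (cycle_arcs vs) = tl vs @ [hd vs]"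
  by (simp add: cycle_arcs_def)

lemma cycle_arcs_nth:
  assumes "i < length vs"
  shows "cycle_arcs vs ! i = (vs ! i, if Suc i < length vs then vs ! Suc i else hd vs)"
  using assms by (auto simp: cycle_arcs_def nth_append nth_tl)

lemma set_cycle_arcs:
  assumes "vs \<noteq> []"
  shows "set (cycle_arcs vs) =
    insert (last vs, hd vs) {(vs ! i, vs ! Suc i) |i. Suc i < length vs}" (is "?A = ?B")
proof -
  have "?A = {cycle_arcs vs ! i |i. i < length vs}"
    using assms by (simp add: set_conv_nth length_cycle_arcs)
  also have "\<dots> = {(vs ! i, if Suc i < length vs then vs ! Suc i else hd vs) |i. i < length vs}"
    by (metis cycle_arcs_nth)
  also have "\<dots> = ?B"
  proof (intro equalityI subsetI)
    fix e assume "e \<in> {(vs ! i, if Suc i < length vs then vs ! Suc i else hd vs) |i. i < length vs}"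
    then obtain i where i: "i < length vs"
      "e = (vs ! i, if Suc i < length vs then vs ! Suc i else hd vs)" by blast
    show "e \<in> ?B"
    proof (cases "Suc i < length vs")
      case False
      then have "i = length vs - 1" using i by simp
      then show ?thesis using False i assms by (simp add: last_conv_nth)
    qed (use i in auto)
  next
    fix e assume "e \<in> ?B"
    then show "e \<in> {(vs ! i, if Suc i < length vs then vs ! Suc i else hd vs) |i. i < length vs}"
    proof
      assume "e = (last vs, hd vs)"
      then show ?thesis using assms
        by (intro CollectI exI[of _ "length vs - 1"]) (simp add: last_conv_nth)
    next
      assume "e \<in> {(vs ! i, vs ! Suc i) |i. Suc i < length vs}"
      then obtain i where "Suc i < length vs" "e = (vs ! i, vs ! Suc i)" by blast
      then show ?thesis by (intro CollectI exI[of _ i]) simp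
    qed
  qed
  finally show ?thesis .
qed

text \<open>Trades the recursion of \<open>pcas\<close> for two end conditions and one equation
  between lists of arc heads and arc tails, which can be compared with
  \<open>cycle_arcs\<close>.\<close>

lemma pcas_iff:
  "c \<noteq> [] \<Longrightarrow> pcas u c v \<longleftrightarrow> u = fst (hd c) \<and> v = snd (last c) \<and> map snd (butlast c) = map fst (tl c)"
proof (induction c arbitrary: u)
  case (Cons e c)
  show ?case
  proof (cases "c = []")
    case False
    then obtain e' c' where c: "c = e' # c'" by (cases c) auto
    have "pcas (snd e) c v \<longleftrightarrow> snd e = fst (hd c) \<and> v = snd (last c) \<and> map snd (butlast c) = map fst (tl c)"
      using Cons.IH False by blast
    then show ?thesis by (auto simp: c)
  qed auto
qed simp

text \<open>A list of pairs is determined by its two projections. The first projections agree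
  automatically; equality of the second ones says that consecutive arcs fit together and that the
  last arc returns to the start.\<close>

lemma closed_pcas_conv_cycle_arcs:
  assumes "c \<noteq> []"
  shows "pcas u c u \<longleftrightarrow> u = fst (hd c) \<and> c = cycle_arcs (map fst c)"
proof -
  have "c = cycle_arcs (map fst c) \<longleftrightarrow> map snd c = map snd (cycle_arcs (map fst c))"
    using assms map_fst_cycle_arcs[of "map fst c"]
    by (metis map_is_Nil_conv zip_map_fst_snd)
  also have "map snd c = map snd (butlast c) @ [snd (last c)]"
    using append_butlast_last_id[OF assms] by (metis list.map(1,2) map_append)
  also have "map snd (cycle_arcs (map fst c)) = map fst (tl c) @ [fst (hd c)]"
    using assms by (simp add: map_snd_cycle_arcs map_tl hd_map)
  finally show ?thesis using assms by (auto simp: pcas_iff)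
qed

context pair_loopfree_digraph
begin

lemma arcs_irrefl: "(x, x) \<notin> parcs G"
  using pair_no_loops[of "(x, x)"] by auto

text \<open>\<open>cycle\<close> demands distinctness of the vertices of the walk after its start,
  here \<open>tl vs @ [hd vs]\<close>, which is a rotation of \<open>vs\<close>.\<close>

lemma cycle_cycle_arcs_iff:
  assumes "vs \<noteq> []"
  shows "cycle (cycle_arcs vs) \<longleftrightarrow> vcycle (parcs G) vs"
proof -
  let ?c = "cycle_arcs vs"
  have ne: "?c \<noteq> []" using assms length_cycle_arcs[OF assms] by auto
  have hd: "fst (hd ?c) = hd vs" using map_fst_cycle_arcs[OF assms] ne by (metis hd_map)
  have cas: "pcas u ?c u \<longleftrightarrow> u = hd vs" for u
    using closed_pcas_conv_cycle_arcs[OF ne] map_fst_cycle_arcs[OF assms] hd by simp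
  have "pawalk_verts u ?c = vs @ [snd (last ?c)]" for u
    using awalk_verts_conv[of u ?c] ne map_fst_cycle_arcs[OF assms] by simp
  moreover have "snd (last ?c) = hd vs"
    using map_snd_cycle_arcs[OF assms] ne by (metis last_map last_snoc)
  ultimately have verts: "tl (pawalk_verts u ?c) = tl vs @ [hd vs]" for u
    using assms by simp
  have dist: "distinct (tl vs @ [hd vs]) \<longleftrightarrow> distinct vs" using assms by (cases vs) auto
  have "cycle ?c \<longleftrightarrow> hd vs \<in> pverts G \<and> set ?c \<subseteq> parcs G \<and> distinct vs"
    unfolding cycle_def awalk_def using ne cas verts dist by auto
  also have "\<dots> \<longleftrightarrow> set ?c \<subseteq> parcs G \<and> distinct vs"
    using arc_fst_in_verts[of "hd ?c"] hd hd_in_set[OF ne] by (metis subsetD)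
  also have "\<dots> \<longleftrightarrow> vcycle (parcs G) vs"
    unfolding vcycle_def set_cycle_arcs[OF assms] by auto
  finally show ?thesis .
qed

lemma cycle_conv_vcycle: "cycle c \<longleftrightarrow> (\<exists>vs. vs \<noteq> [] \<and> c = cycle_arcs vs \<and> vcycle (parcs G) vs)"
proof
  assume c: "cycle c"
  then obtain u where u: "pcas u c u" and ne: "c \<noteq> []" by (auto simp: cycle_def awalk_def)
  have eq: "c = cycle_arcs (map fst c)"
    using iffD1[OF closed_pcas_conv_cycle_arcs[OF ne] u] by (rule conjunct2)
  then have "vcycle (parcs G) (map fst c)"
    using c ne cycle_cycle_arcs_iff[of "map fst c"] unfolding eq[symmetric] by simp
  then show "\<exists>vs. vs \<noteq> [] \<and> c = cycle_arcs vs \<and> vcycle (parcs G) vs"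
    using eq ne by (intro exI[of _ "map fst c"]) simp
qed (use cycle_cycle_arcs_iff in auto)

end

context pair_bidirected_digraph
begin

lemma arcs_sym: "(x, y) \<in> parcs G \<Longrightarrow> (y, x) \<in> parcs G"
  using arcs_symmetric by blast

text \<open>By distinctness, vertices correspond to positions. The closing arc joins positions
  \<open>0\<close> and \<open>length vs - 1\<close>, which is the pair ruled out by the disjunction
  in \<open>vchord\<close>.\<close>

lemma ex_chord_cycle_arcs_iff:
  assumes "vs \<noteq> []" "distinct vs"
  shows "(\<exists>x y. chord G (cycle_arcs vs) x y) \<longleftrightarrow> (\<exists>i j. vchord (parcs G) vs i j)"
proof
  have fst_set: "fst ` set (cycle_arcs vs) = set vs"
    using map_fst_cycle_arcs[OF assms(1)] by (metis list.set_map)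
  assume "\<exists>x y. chord G (cycle_arcs vs) x y"
  then obtain x y where xy: "x \<in> set vs" "y \<in> set vs" "(x, y) \<in> parcs G"
    "(x, y) \<notin> set (cycle_arcs vs)" "(y, x) \<notin> set (cycle_arcs vs)"
    unfolding chord_def fst_set by blast
  obtain i j where ij: "i < length vs" "x = vs ! i" "j < length vs" "y = vs ! j"
    using xy(1,2) by (metis in_set_conv_nth)
  have "i \<noteq> j" using xy(3) ij arcs_irrefl by auto
  \<comment> \<open>Stated for increasing positions only; the other order follows from the symmetry
    of the arcs.\<close>
  have *: "vchord (parcs G) vs i j" if "i < j" "j < length vs" "(vs ! i, vs ! j) \<in> parcs G"
    "(vs ! i, vs ! j) \<notin> set (cycle_arcs vs)" "(vs ! j, vs ! i) \<notin> set (cycle_arcs vs)" for i j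
  proof -
    have "j \<noteq> Suc i" using that unfolding set_cycle_arcs[OF assms(1)] by auto
    moreover have "\<not> (i = 0 \<and> Suc j = length vs)"
    proof
      assume ends: "i = 0 \<and> Suc j = length vs"
      then have "j = length vs - 1" by linarith
      then have "vs ! i = hd vs" "vs ! j = last vs" using ends assms(1)
        by (simp_all add: hd_conv_nth last_conv_nth)
      then show False using that unfolding set_cycle_arcs[OF assms(1)] by auto
    qed
    ultimately show ?thesis using that unfolding vchord_def by auto
  qed
  show "\<exists>i j. vchord (parcs G) vs i j"
  proof (cases "i < j")
    case True then show ?thesis using * xy ij by blast
  next
    case False then show ?thesis using * xy ij \<open>i \<noteq> j\<close> arcs_sym by (metis nat_neq_iff)
  qed
next
  have fst_set: "fst ` set (cycle_arcs vs) = set vs"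
    using map_fst_cycle_arcs[OF assms(1)] by (metis list.set_map)
  assume "\<exists>i j. vchord (parcs G) vs i j"
  then obtain i j where ij: "Suc i < j" "j < length vs" "0 < i \<or> Suc j < length vs"
    "(vs ! i, vs ! j) \<in> parcs G" unfolding vchord_def by blast
  have eq: "vs ! k = vs ! l \<longleftrightarrow> k = l" if "k < length vs" "l < length vs" for k l
    using that assms(2) by (simp add: nth_eq_iff_index_eq)
  have last: "last vs = vs ! (length vs - 1)" and hd: "hd vs = vs ! 0"
    using assms(1) by (simp_all add: last_conv_nth hd_conv_nth)
  have "vs ! i \<noteq> vs ! 0 \<or> Suc j < length vs" using ij eq[of i 0] assms(1) by auto
  then have "(vs ! i, vs ! j) \<notin> set (cycle_arcs vs)" "(vs ! j, vs ! i) \<notin> set (cycle_arcs vs)"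
    unfolding set_cycle_arcs[OF assms(1)] last hd using ij by (auto simp: eq)
  then show "\<exists>x y. chord G (cycle_arcs vs) x y"
    unfolding chord_def fst_set using ij by (intro exI[of _ "vs ! i"] exI[of _ "vs ! j"]) auto
qed

lemma chordal_iff_vchordal: "chordal G \<longleftrightarrow> vchordal (parcs G)"
proof
  assume L: "chordal G"
  show "vchordal (parcs G)" unfolding vchordal_def
  proof (intro allI impI)
    fix vs assume vs: "vcycle (parcs G) vs \<and> 4 \<le> length vs"
    then have ne: "vs \<noteq> []" by auto
    then have "cycle (cycle_arcs vs)" "4 \<le> length (cycle_arcs vs)"
      using vs cycle_cycle_arcs_iff by (auto simp: length_cycle_arcs)
    then have "\<exists>x y. chord G (cycle_arcs vs) x y" using L unfolding chordal_def by blast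
    then show "\<exists>i j. vchord (parcs G) vs i j"
      using ex_chord_cycle_arcs_iff[OF ne] vs unfolding vcycle_def by blast
  qed
next
  assume R: "vchordal (parcs G)"
  show "chordal G" unfolding chordal_def
  proof (intro allI impI)
    fix c assume c: "cycle c \<and> 4 \<le> length c"
    then obtain vs where vs: "vs \<noteq> []" "c = cycle_arcs vs" "vcycle (parcs G) vs"
      using cycle_conv_vcycle by blast
    then have "\<exists>i j. vchord (parcs G) vs i j"
      using R c length_cycle_arcs[OF vs(1)] unfolding vchordal_def by auto
    then show "\<exists>x y. chord G c x y"
      using ex_chord_cycle_arcs_iff[OF vs(1)] vs unfolding vcycle_def by blast
  qed
qed

end

section \<open>Clique separators and chordality\<close>

lemma stays_in_side:
  assumes "i \<le> j" "vs ! i \<in> L" "\<And>k. i \<le> k \<Longrightarrow> k \<le> j \<Longrightarrow> vs ! k \<notin> S"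
    and "\<And>k. i \<le> k \<Longrightarrow> k < j \<Longrightarrow> (vs ! k, vs ! Suc k) \<in> E"
    and "\<And>a b. (a, b) \<in> E \<Longrightarrow> a \<in> L \<Longrightarrow> b \<in> L \<union> S"
  shows "vs ! j \<in> L"
  using assms(1,3,4)
proof (induction rule: dec_induct)
  case base
  show ?case by (fact assms(2))
next
  case (step n)
  have "vs ! n \<in> L" using step.prems by (intro step.IH) auto
  moreover have "(vs ! n, vs ! Suc n) \<in> E" using step.prems(2)[of n] step.hyps by simp
  ultimately show ?case using assms(5) step.prems(1)[of "Suc n"] step.hyps by auto
qed

lemma separated_cycle_vchord:
  assumes cyc: "vcycle E vs"
    and ab: "a < b" "b < length vs" "vs ! a \<in> L" "vs ! b \<in> R"
    and disj: "L \<inter> R = {}" "L \<inter> S = {}" "R \<inter> S = {}"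
    and L: "\<And>a b. (a, b) \<in> E \<Longrightarrow> a \<in> L \<Longrightarrow> b \<in> L \<union> S"
    and R: "\<And>a b. (a, b) \<in> E \<Longrightarrow> a \<in> R \<Longrightarrow> b \<in> R \<union> S"
    and S: "\<And>a b. a \<in> S \<Longrightarrow> b \<in> S \<Longrightarrow> a \<noteq> b \<Longrightarrow> (a, b) \<in> E"
  shows "\<exists>i j. vchord E vs i j"
  \<comment> \<open>Each of the two arcs of the cycle between positions \<open>a\<close> and \<open>b\<close> has an interior vertex in the clique \<open>S\<close>.\<close>
proof -
  have E: "(vs ! k, vs ! Suc k) \<in> E" if "Suc k < length vs" for k
    using cyc that unfolding vcycle_def by blast
  have ne: "vs \<noteq> []" using ab by auto
  have wrap: "(vs ! (length vs - 1), vs ! 0) \<in> E"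
    using cyc ne unfolding vcycle_def by (simp add: last_conv_nth hd_conv_nth)
  have inS: "vs ! i \<in> S \<Longrightarrow> vs ! j \<in> S \<Longrightarrow> i < length vs \<Longrightarrow> j < length vs \<Longrightarrow> i \<noteq> j \<Longrightarrow>
      (vs ! i, vs ! j) \<in> E" for i j
    using S cyc unfolding vcycle_def by (simp add: nth_eq_iff_index_eq)
  \<comment> \<open>Without such a position the cycle would stay in \<open>L\<close> all the way
    from \<open>a\<close> to \<open>b\<close>.\<close>
  have "\<exists>i. a \<le> i \<and> i \<le> b \<and> vs ! i \<in> S"
  proof (rule ccontr)
    assume *: "\<not> ?thesis"
    have "vs ! b \<in> L"
    proof (rule stays_in_side[of a b vs L S E])
      show "a \<le> b" "vs ! a \<in> L" using ab by auto
      show "vs ! k \<notin> S" if "a \<le> k" "k \<le> b" for k using * that by blast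
      show "(vs ! k, vs ! Suc k) \<in> E" if "a \<le> k" "k < b" for k using that ab E by simp
    qed (fact L)
    then show False using ab disj by blast
  qed
  then obtain i where "a \<le> i" "i \<le> b" "vs ! i \<in> S" by blast
  then have i: "a < i" "i < b" "vs ! i \<in> S"
    using ab disj by (auto simp: le_less)
  \<comment> \<open>Otherwise the cycle would stay in \<open>R\<close> from \<open>b\<close> to the
    end of the list, over the closing edge to position \<open>0\<close>, and on to
    \<open>a\<close>.\<close>
  have "\<exists>k < length vs. (k < a \<or> b < k) \<and> vs ! k \<in> S"
  proof (rule ccontr)
    assume *: "\<not> ?thesis"
    have nS: "vs ! k \<notin> S" if "k < length vs" "k \<le> a \<or> b \<le> k" for k
      using * that ab disj by (metis IntI emptyE le_less)
    have last: "vs ! (length vs - 1) \<in> R"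
    proof (rule stays_in_side[of b "length vs - 1" vs R S E])
      show "b \<le> length vs - 1" "vs ! b \<in> R" using ab by auto
      show "vs ! k \<notin> S" if "b \<le> k" "k \<le> length vs - 1" for k using nS[of k] that ne
        by (cases vs) auto
      show "(vs ! k, vs ! Suc k) \<in> E" if "b \<le> k" "k < length vs - 1" for k using that E by simp
    qed (fact R)
    have first: "vs ! 0 \<in> R" using R[OF wrap last] nS[of 0] ne by auto
    have "vs ! a \<in> R"
    proof (rule stays_in_side[of 0 a vs R S E])
      show "vs ! k \<notin> S" if "0 \<le> k" "k \<le> a" for k using nS[of k] that ab by simp
      show "(vs ! k, vs ! Suc k) \<in> E" if "0 \<le> k" "k < a" for k using that ab E by simp
    qed (use first R in auto)
    then show False using ab disj by blast
  qed
  then obtain k where k: "k < length vs" "k < a \<or> b < k" "vs ! k \<in> S" by blast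
  \<comment> \<open>One of \<open>a\<close>, \<open>b\<close> lies between the positions
    \<open>i\<close> and \<open>k\<close>, and the other lies between them the other way around the
    cycle, so they are not cyclically consecutive.\<close>
  show ?thesis
  proof (cases "k < a")
    case True
    then have "vchord E vs k i" unfolding vchord_def using k i ab inS by auto
    then show ?thesis by blast
  next
    case False
    then have "vchord E vs i k" unfolding vchord_def using k i ab inS by auto
    then show ?thesis by blast
  qed
qed

text \<open>A cycle of the smaller relation that meets both sides passes through the clique
  \<open>S\<close> twice and has a chord there, and no edge inside \<open>S\<close> is removed. A
  cycle that misses one side has a chord in \<open>E\<close>, which cannot be a removed
  edge.\<close>

lemma vchordal_remove_across:
  assumes "vchordal E" "sym E" "Field E \<subseteq> L \<union> S \<union> R"
    and "L \<inter> R = {}" "L \<inter> S = {}" "R \<inter> S = {}"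
    and S: "\<And>a b. a \<in> S \<Longrightarrow> b \<in> S \<Longrightarrow> a \<noteq> b \<Longrightarrow> (a, b) \<in> E"
  shows "vchordal (E - (L \<times> R \<union> R \<times> L))" (is "vchordal ?E")
  unfolding vchordal_def
proof (intro allI impI)
  fix vs assume vs: "vcycle ?E vs \<and> 4 \<le> length vs"
  have field: "a \<in> L \<union> S \<union> R \<and> b \<in> L \<union> S \<union> R" if "(a, b) \<in> E" for a b
    using that assms(3) by (auto simp: Field_def)
  \<comment> \<open>Either side may come first in \<open>vs\<close>, hence the two assignments of
    \<open>A\<close> and \<open>B\<close>.\<close>
  have crossing: "\<exists>i j. vchord ?E vs i j"
    if "a < b" "b < length vs" "vs ! a \<in> A" "vs ! b \<in> B" "A = L \<and> B = R \<or> A = R \<and> B = L"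
    for a b A B
    using that(5)
  proof (intro separated_cycle_vchord[where S = S, OF _ that(1-4)])
    show "b \<in> A \<union> S" if "(a, b) \<in> ?E" "a \<in> A" for a b
      using that \<open>A = L \<and> B = R \<or> A = R \<and> B = L\<close> field[of a b] by auto
    show "b \<in> B \<union> S" if "(a, b) \<in> ?E" "a \<in> B" for a b
      using that \<open>A = L \<and> B = R \<or> A = R \<and> B = L\<close> field[of a b] by auto
  qed (use vs assms(4-6) S that(5) in auto)
  show "\<exists>i j. vchord ?E vs i j"
  proof (cases "\<exists>a b. a < length vs \<and> b < length vs \<and> vs ! a \<in> L \<and> vs ! b \<in> R")
    case True
    then obtain a b where ab: "a < length vs" "b < length vs" "vs ! a \<in> L" "vs ! b \<in> R" by blast
    then have "a \<noteq> b" using assms(4) by auto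
    then show ?thesis using ab crossing[of a b L R] crossing[of b a R L] by (meson nat_neq_iff)
  next
    case False
    have "vcycle E vs" using vs unfolding vcycle_def by auto
    then obtain i j where "vchord E vs i j" using vs assms(1) unfolding vchordal_def by blast
    then have "vchord ?E vs i j" using False unfolding vchord_def by auto
    then show ?thesis by blast
  qed
qed

section \<open>Shortest walks and chordless detours\<close>

lemma successively_take_drop:
  assumes "successively P xs"
  shows "successively P (take n xs)" "successively P (drop n xs)"
  using assms successively_append_iff[of P "take n xs" "drop n xs"] by simp_all

text \<open>In a walk of minimal length inside \<open>W\<close>, an edge between non-consecutive
  positions or a repeated vertex would allow a stretch to be cut out, leaving a shorter walk on the
  same vertex set or a subset of it.\<close>

lemma ex_shortest_walk:
  assumes "successively (\<lambda>a b. (a, b) \<in> E) p" "p \<noteq> []" "hd p = x" "last p = y" "set p \<subseteq> W"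
  obtains q where "successively (\<lambda>a b. (a, b) \<in> E) q" "q \<noteq> []" "hd q = x" "last q = y" "set q \<subseteq> W"
    "distinct q" "\<And>i j. Suc i < j \<Longrightarrow> j < length q \<Longrightarrow> (q ! i, q ! j) \<notin> E"
proof -
  let ?walk = "\<lambda>q. successively (\<lambda>a b. (a, b) \<in> E) q \<and> q \<noteq> [] \<and> hd q = x \<and> last q = y \<and> set q \<subseteq> W"
  obtain q where q: "?walk q" and min: "\<And>r. ?walk r \<Longrightarrow> length q \<le> length r"
    using ex_has_least_nat[of ?walk p length] assms by blast
  have shortcut: "(q ! i, q ! j) \<notin> E" if ij: "Suc i < j" "j < length q" for i j
  proof
    assume e: "(q ! i, q ! j) \<in> E"
    let ?r = "take (Suc i) q @ drop j q"
    have "successively (\<lambda>a b. (a, b) \<in> E) q" using q by blast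
    then have "successively (\<lambda>a b. (a, b) \<in> E) (take (Suc i) q)" "successively (\<lambda>a b. (a, b) \<in> E) (drop j q)"
      by (fact successively_take_drop)+
    moreover have "last (take (Suc i) q) = q ! i" using ij by (simp add: take_Suc_conv_app_nth)
    moreover have "hd (drop j q) = q ! j" using ij by (simp add: hd_drop_conv_nth)
    ultimately have "successively (\<lambda>a b. (a, b) \<in> E) ?r" using e by (auto simp: successively_append_iff)
    moreover have "?r \<noteq> []" "hd ?r = x" "last ?r = y" "set ?r \<subseteq> W"
      using q ij by (auto dest: in_set_takeD in_set_dropD)
    ultimately have "length q \<le> length ?r" using min by blast
    then show False using ij by simp
  qed
  have "q ! i \<noteq> q ! j" if ij: "i < j" "j < length q" for i j
  proof
    assume e: "q ! i = q ! j"
    \<comment> \<open>The stretch between the two occurrences is cut out; the edge into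
      \<open>q ! i\<close> now serves as the edge into \<open>q ! j\<close>.\<close>
    let ?r = "take i q @ drop j q"
    have suc: "successively (\<lambda>a b. (a, b) \<in> E) q" using q by blast
    then have "successively (\<lambda>a b. (a, b) \<in> E) (take i q)" "successively (\<lambda>a b. (a, b) \<in> E) (drop j q)"
      by (fact successively_take_drop)+
    moreover have "(last (take i q), hd (drop j q)) \<in> E" if nonempty: "take i q \<noteq> []"
    proof -
      obtain k where k: "i = Suc k" using nonempty by (cases i) auto
      then have "(q ! k, q ! i) \<in> E" using suc ij by (simp add: successively_conv_nth)
      then show ?thesis using ij k e by (simp add: take_Suc_conv_app_nth hd_drop_conv_nth)
    qed
    ultimately have "successively (\<lambda>a b. (a, b) \<in> E) ?r" by (auto simp: successively_append_iff)
    \<comment> \<open>For \<open>i = 0\<close> the first piece is empty, and the walk starts at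
      \<open>q ! j\<close>, which equals \<open>q ! 0\<close>.\<close>
    moreover have "hd ?r = x"
    proof (cases i)
      case 0
      then have "hd ?r = q ! i" using ij e by (simp add: hd_drop_conv_nth)
      then show ?thesis using q 0 by (metis hd_conv_nth)
    qed (use q in \<open>auto simp: hd_append\<close>)
    moreover have "?r \<noteq> []" "last ?r = y" "set ?r \<subseteq> W"
      using q ij by (auto dest: in_set_takeD in_set_dropD)
    ultimately have "length q \<le> length ?r" using min by blast
    then show False using ij by simp
  qed
  then have "distinct q" by (metis distinct_conv_nth nat_neq_iff)
  then show thesis using q shortcut that by blast
qed

text \<open>For a shortest walk \<open>q\<close> on the vertices of \<open>p\<close>, a chord of the
  cycle \<open>v # q\<close> either joins non-consecutive positions of \<open>q\<close>, against
  minimal length, or joins \<open>v\<close> to an inner vertex of \<open>q\<close>, against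
  \<open>int\<close>.\<close>

lemma vchordal_detour_adjacent:
  assumes "vchordal E" "sym E" "x \<noteq> y" "(v, x) \<in> E" "(v, y) \<in> E" "x \<noteq> v" "y \<noteq> v"
    and p: "successively (\<lambda>a b. (a, b) \<in> E) p" "p \<noteq> []" "hd p = x" "last p = y"
    and int: "(set p - {x, y}) \<inter> ({v} \<union> {u. (v, u) \<in> E}) = {}"
  shows "(x, y) \<in> E"
proof (rule ccontr)
  assume xy: "(x, y) \<notin> E"
  obtain q where q: "successively (\<lambda>a b. (a, b) \<in> E) q" "q \<noteq> []" "hd q = x" "last q = y"
    "set q \<subseteq> set p" "distinct q" "\<And>i j. Suc i < j \<Longrightarrow> j < length q \<Longrightarrow> (q ! i, q ! j) \<notin> E"
    using ex_shortest_walk[OF p subset_refl] by metis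
  have q0: "q ! 0 = x" and ql: "q ! (length q - 1) = y"
    using q by (simp_all add: hd_conv_nth last_conv_nth)
  \<comment> \<open>As \<open>x\<close> and \<open>y\<close> are distinct and assumed non-adjacent,
    \<open>q\<close> has at least three vertices, so \<open>v # q\<close> has at least four.\<close>
  have "length q \<noteq> 1" using q0 ql assms(3) by auto
  moreover have "length q \<noteq> 2"
  proof
    assume "length q = 2"
    then have "(q ! 0, q ! 1) \<in> E" "q ! 1 = y" using q(1) ql by (auto simp: successively_conv_nth)
    then show False using q0 xy by simp
  qed
  moreover have "length q \<noteq> 0" using q by simp
  ultimately have len: "3 \<le> length q" by linarith
  have intq: "(v, u) \<notin> E" "u \<noteq> v" if "u \<in> set q" "u \<noteq> x" "u \<noteq> y" for u
    using that int q(5) by auto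
  have "v \<notin> set q" using intq(2) assms(6,7) by blast
  then have "vcycle E (v # q)" unfolding vcycle_def
    using q assms(2,4,5) q0 by (auto simp: nth_Cons successively_conv_nth split: nat.split dest: symD)
  then obtain i j where ij: "vchord E (v # q) i j" using assms(1) len unfolding vchordal_def
    by fastforce
  then obtain j' where j': "j = Suc j'" unfolding vchord_def by (cases j) auto
  show False
  proof (cases i)
    \<comment> \<open>A chord at \<open>v\<close>: the bounds in \<open>vchord\<close> place its
      other end at neither the first nor the last position of \<open>q\<close>.\<close>
    case 0
    then have j: "0 < j'" "Suc j' < length q" "(v, q ! j') \<in> E" using ij j' unfolding vchord_def by auto
    then have "q ! j' \<noteq> q ! 0" "q ! j' \<noteq> q ! (length q - 1)"
      using nth_eq_iff_index_eq[OF q(6), of j' 0] nth_eq_iff_index_eq[OF q(6), of j' "length q - 1"] len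
      by linarith+
    then have "q ! j' \<noteq> x" "q ! j' \<noteq> y" using q0 ql by auto
    then show False using intq(1)[of "q ! j'"] j by simp
  next
    case (Suc i')
    then show False using ij j' q(7)[of i' j'] unfolding vchord_def by auto
  qed
qed

section \<open>Fill edges and minimal triangulations\<close>

lemma pair_graph_alter_arcs:
  assumes "pair_graph G" "sym E" "\<And>a b. (a, b) \<in> E \<Longrightarrow> a \<in> pverts G \<and> b \<in> pverts G \<and> a \<noteq> b"
  shows "pair_graph (G\<lparr>parcs := E\<rparr>)"
proof -
  interpret pair_graph G by fact
  have "E \<subseteq> pverts G \<times> pverts G" using assms(3) by auto
  then have "finite E" by (rule finite_subset) (simp add: pair_finite_verts)
  then show ?thesis
    by unfold_locales (use assms pair_finite_verts in \<open>auto simp: symmetric_def\<close>)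
qed

lemma pair_graph_add_edges:
  assumes "pair_graph G" "sym F" "F \<subseteq> non_edges G"
  shows "pair_graph (add_edges G F)"
proof -
  interpret pair_graph G by fact
  show ?thesis unfolding add_edges_def
    by (rule pair_graph_alter_arcs)
      (use assms pair_sym_arcs wellformed' arcs_irrefl in \<open>auto simp: symmetric_def non_edges_def intro: sym_Un\<close>)
qed

lemma chordal_add_edges_iff:
  assumes "pair_graph G" "sym F" "F \<subseteq> non_edges G"
  shows "chordal (add_edges G F) \<longleftrightarrow> vchordal (parcs G \<union> F)"
proof -
  interpret H: pair_graph "add_edges G F" using pair_graph_add_edges[OF assms] .
  show ?thesis using H.chordal_iff_vchordal by (simp add: add_edges_def)
qed

text \<open>Having no fill edge at \<open>v\<close> is inherited by subsets of the fill set. Hence a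
  fill set that is minimal among those with this property is minimal among all fill sets.\<close>

lemma ex_minimal_triangulation_same_nbhd:
  assumes "pair_graph G" "v \<in> pverts G"
  shows "\<exists>H. minimal_triangulation G H \<and> nbhd H v = nbhd G v"
proof -
  interpret pair_graph G by fact
  let ?fill = "\<lambda>F. triangulation_by G F (add_edges G F) \<and> (\<forall>u. (v, u) \<notin> F)"
  \<comment> \<open>Making all vertices other than \<open>v\<close> adjacent gives a first triangulation without fill edges at \<open>v\<close>.\<close>
  define F0 where "F0 = {(a, b) \<in> non_edges G. a \<noteq> v \<and> b \<noteq> v}"
  have F0: "sym F0" "F0 \<subseteq> non_edges G" using arcs_sym by (auto simp: F0_def sym_def non_edges_def)
  have "vchordal (parcs G \<union> F0)" unfolding vchordal_def
  proof (intro allI impI)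
    fix vs assume vs: "vcycle (parcs G \<union> F0) vs \<and> 4 \<le> length vs"
    have verts: "vs ! i \<in> pverts G" if "Suc i < length vs" for i
      using vs that wellformed' unfolding vcycle_def F0_def non_edges_def by blast
    have last: "vs ! (length vs - 1) \<in> pverts G"
    proof -
      have "(last vs, hd vs) \<in> parcs G \<union> F0" using vs unfolding vcycle_def by blast
      then have "last vs \<in> pverts G" using wellformed' unfolding F0_def non_edges_def by blast
      then show ?thesis using vs by (metis last_conv_nth list.size(3) not_numeral_le_zero)
    qed
    have verts: "vs ! i \<in> pverts G" if "i < length vs" for i
      
    proof (cases "Suc i < length vs")
      case False
      then have "i = length vs - 1" using that by simp
      then show ?thesis using last by simp
    qed (fact verts)
    have eq: "vs ! i = vs ! j \<longleftrightarrow> i = j" if "i < length vs" "j < length vs" for i j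
      using vs that unfolding vcycle_def by (simp add: nth_eq_iff_index_eq)
    have *: "vchord (parcs G \<union> F0) vs i j"
      if "Suc i < j" "j < length vs" "0 < i \<or> Suc j < length vs" "vs ! i \<noteq> v" "vs ! j \<noteq> v" for i j
      unfolding vchord_def F0_def non_edges_def using that verts eq[of i j] by auto
    \<comment> \<open>\<open>v\<close> occurs at most once on the cycle, so one of the position
      pairs \<open>0, 2\<close> and \<open>1, 3\<close> avoids it, and any two vertices other than
      \<open>v\<close> are adjacent.\<close>
    show "\<exists>i j. vchord (parcs G \<union> F0) vs i j"
    proof (cases "vs ! 0 = v \<or> vs ! 2 = v")
      case True
      have "0 < length vs" "1 < length vs" "2 < length vs" "3 < length vs" using vs by auto
      then have "vs ! 1 \<noteq> v" "vs ! 3 \<noteq> v" using True eq[of 0 1] eq[of 2 1] eq[of 0 3] eq[of 2 3]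
        by auto
      then show ?thesis using *[of 1 3] vs by auto
    next
      case False
      then show ?thesis using *[of 0 2] vs by auto
    qed
  qed
  then have "?fill F0"
    using F0 chordal_add_edges_iff[OF assms(1) F0] unfolding triangulation_by_def by (auto simp: F0_def)
  moreover have "finite {F. ?fill F}"
  proof (rule finite_subset)
    show "{F. ?fill F} \<subseteq> Pow (pverts G \<times> pverts G)"
      unfolding triangulation_by_def non_edges_def by auto
  qed (simp add: pair_finite_verts)
  ultimately obtain F where F: "?fill F" and min: "\<And>F'. ?fill F' \<Longrightarrow> F' \<subseteq> F \<Longrightarrow> F' = F"
    using finite_has_minimal[of "{F. ?fill F}"] by (simp (no_asm_use)) metis
  have "minimal_triangulation G (add_edges G F)" unfolding minimal_triangulation_def
  proof (intro exI[of _ F] conjI allI impI notI)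
    fix F' assume F': "sym F' \<and> F' \<subset> F" "chordal (add_edges G F')"
    then have "?fill F'" using F unfolding triangulation_by_def by blast
    then show False using min F' by blast
  qed (use F in blast)
  moreover have "nbhd (add_edges G F) v = nbhd G v"
    using F by (auto simp: nbhd_def add_edges_def)
  ultimately show ?thesis by blast
qed

section \<open>The two implications\<close>

lemma simplicial_triangulation_if_avoidable:
  assumes "pair_graph G" "avoidable G v" "minimal_triangulation G H" "nbhd H v = nbhd G v"
  shows "simplicial H v"
proof -
  interpret pair_graph G by fact
  obtain F where F: "sym F" "F \<subseteq> non_edges G" "H = add_edges G F" "chordal H"
    using assms(3) unfolding minimal_triangulation_def triangulation_by_def by blast
  have pH: "parcs H = parcs G \<union> F" "pverts H = pverts G" by (auto simp: F add_edges_def)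
  interpret H: pair_graph H using pair_graph_add_edges[OF assms(1) F(1,2)] F(3) by simp
  have "(x, y) \<in> parcs H" if xy: "x \<in> nbhd H v" "y \<in> nbhd H v" "x \<noteq> y" for x y
  proof -
    obtain p where p: "apath x p y" "(set (pawalk_verts x p) - {x, y}) \<inter> ({v} \<union> nbhd G v) = {}"
      using assms(2,4) xy unfolding avoidable_def awalk_verts_with_proj_eq by metis
    \<comment> \<open>A walk of \<open>G\<close>, given by arcs, is turned into a vertex walk of
      \<open>H\<close>, whose arcs include those of \<open>G\<close>.\<close>
    have walk: "successively (\<lambda>a b. (a, b) \<in> parcs H) (pawalk_verts x p) \<and> hd (pawalk_verts x p) = x \<and>
        last (pawalk_verts x p) = y" if "awalk x p y" for x p
      using that
    proof (induction p arbitrary: x)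
      case (Cons e p)
      then show ?case by (cases p) (auto simp: awalk_Cons_iff awalk_Nil_iff pH)
    qed (simp add: awalk_Nil_iff)
    show ?thesis
    proof (rule vchordal_detour_adjacent)
      show "vchordal (parcs H)" using H.chordal_iff_vchordal F(4) by blast
      show "sym (parcs H)" using H.arcs_sym by (auto simp: sym_def)
      show "(v, x) \<in> parcs H" "(v, y) \<in> parcs H" using xy by (auto simp: nbhd_def)
      then show "x \<noteq> v" "y \<noteq> v" using H.arcs_irrefl by auto
      \<comment> \<open>Avoidability speaks of the neighbourhood in \<open>G\<close>, the detour
        lemma of that in \<open>H\<close>; here the two coincide.\<close>
      show "(set (pawalk_verts x p) - {x, y}) \<inter> ({v} \<union> {u. (v, u) \<in> parcs H}) = {}"
        using p(2) assms(4) unfolding nbhd_def by blast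
      show "pawalk_verts x p \<noteq> []" by (cases p) auto
    qed (use xy walk p(1) in \<open>auto simp: apath_def\<close>)
  qed
  moreover have "v \<in> pverts H" using assms(2) by (simp add: pH avoidable_def)
  moreover have "nbhd H v \<subseteq> pverts H" using H.wellformed' by (auto simp: nbhd_def)
  ultimately show ?thesis unfolding simplicial_def clique_def by blast
qed

lemma avoidable_if_simplicial_triangulation:
  assumes "pair_graph G" "minimal_triangulation G H" "simplicial H v"
  shows "avoidable G v"
proof -
  interpret pair_graph G by fact
  obtain F where tri: "triangulation_by G F H"
    and min: "\<forall>F'. sym F' \<and> F' \<subset> F \<longrightarrow> \<not> chordal (add_edges G F')"
    using assms(2) unfolding minimal_triangulation_def by (elim exE conjE)
  have F: "sym F" "F \<subseteq> non_edges G" "H = add_edges G F" "chordal H"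
    using tri unfolding triangulation_by_def by blast+
  have pH: "parcs H = parcs G \<union> F" "pverts H = pverts G" by (auto simp: F add_edges_def)
  interpret H: pair_graph H using pair_graph_add_edges[OF assms(1) F(1,2)] F(3) by simp
  have clq: "(a, b) \<in> parcs H" if "a \<in> nbhd H v" "b \<in> nbhd H v" "a \<noteq> b" for a b
    using assms(3) that by (simp add: simplicial_def clique_def)
  have "\<exists>p. apath x p y \<and> (set (pawalk_verts x p) - {x, y}) \<inter> ({v} \<union> nbhd G v) = {}"
    if xy: "x \<in> nbhd G v" "y \<in> nbhd G v" "x \<noteq> y" for x y
  proof -
    \<comment> \<open>Neighbours are taken in \<open>H\<close>: this makes \<open>S\<close> a clique
      of \<open>H\<close>, and it still contains every vertex that the path sought in
      \<open>G\<close> has to avoid.\<close>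
    define S where "S = {v} \<union> nbhd H v - {x, y}"
    \<comment> \<open>The part of \<open>G\<close> reachable from \<open>x\<close> outside
      \<open>S\<close>. Testing only the heads of the arcs suffices, because \<open>x\<close> is not
      in \<open>S\<close> by definition.\<close>
    define L where "L = {u. \<exists>p. awalk x p u \<and> snd ` set p \<inter> S = {}}"
    define R where "R = pverts G - S - L"
    have xyH: "x \<in> nbhd H v" "y \<in> nbhd H v" "x \<in> pverts G" "y \<in> pverts G" "x \<noteq> v" "y \<noteq> v"
      using xy wellformed' arcs_irrefl by (auto simp: nbhd_def pH)
    have xyE: "(x, y) \<in> parcs H" using clq xyH xy by simp
    have S: "(a, b) \<in> parcs H" if "a \<in> S" "b \<in> S" "a \<noteq> b" for a b
      using that clq[of a b] H.arcs_sym by (auto simp: S_def nbhd_def)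
    have xL: "x \<in> L" unfolding L_def using xyH by (auto intro!: exI[of _ "[]"] simp: awalk_Nil_iff)
    have grow: "b \<in> L" if "a \<in> L" "(a, b) \<in> parcs G" "b \<notin> S" for a b
    proof -
      obtain p where p: "awalk x p a" "snd ` set p \<inter> S = {}" using \<open>a \<in> L\<close> unfolding L_def by blast
      then have "awalk x (p @ [(a, b)]) b"
        using that wellformed' by (auto simp: awalk_simps)
      then show ?thesis unfolding L_def using p that by (intro CollectI exI[of _ "p @ [(a, b)]"]) auto
    qed
    have LS: "L \<inter> S = {}"
    proof -
      have "u \<notin> S" if "awalk x p u" "snd ` set p \<inter> S = {}" for u p
      proof (cases "p = []")
        case True then show ?thesis using that by (auto simp: awalk_Nil_iff S_def)
      next
        case False
        then have "u = snd (last p)" using that by (auto simp: awalk_def pcas_iff)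
        then have "u \<in> snd ` set p" using False by simp
        then show ?thesis using that by blast
      qed
      then show ?thesis unfolding L_def by blast
    qed
    have "y \<in> L"
    proof (rule ccontr)
      assume "y \<notin> L"
      then have yR: "y \<in> R" using xyH by (auto simp: R_def S_def)
      let ?X = "L \<times> R \<union> R \<times> L"
      \<comment> \<open>A \<open>G\<close>-edge leaving \<open>L\<close> ends in \<open>S\<close>,
        so only fill edges are deleted and the result is again \<open>G\<close> with added
        edges.\<close>
      have noG: "parcs G \<inter> ?X = {}" using grow arcs_sym unfolding R_def by blast
      have "vchordal (parcs H - ?X)"
      proof (rule vchordal_remove_across)
        show "vchordal (parcs H)" using H.chordal_iff_vchordal F(4) by blast
        show "sym (parcs H)" using H.arcs_sym by (auto simp: sym_def)
        show "Field (parcs H) \<subseteq> L \<union> S \<union> R"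
          using H.wellformed' by (auto simp: Field_def R_def pH(2))
      qed (use LS S in \<open>auto simp: R_def\<close>)
      moreover have "parcs H - ?X = parcs G \<union> (F - ?X)" using noG by (auto simp: pH)
      moreover have "sym (F - ?X)" using F(1) by (auto simp: sym_def)
      ultimately have "chordal (add_edges G (F - ?X))"
        using chordal_add_edges_iff[OF assms(1), of "F - ?X"] F(2) by auto
      \<comment> \<open>\<open>x\<close> and \<open>y\<close> are adjacent in \<open>H\<close> as
        neighbours of the simplicial vertex \<open>v\<close>. This edge crosses the separation, so
        it is a fill edge, and its deletion makes the new fill set a proper subset.\<close>
      moreover have "(x, y) \<in> F \<inter> ?X" using noG xyE xL yR by (auto simp: pH)
      ultimately show False using min \<open>sym (F - ?X)\<close> by blast
    qed
    then obtain p where p: "awalk x p y" "snd ` set p \<inter> S = {}" unfolding L_def by blast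
    \<comment> \<open>Shortening the walk to a path only drops arcs, so the path still avoids
      \<open>S\<close>.\<close>
    let ?q = "awalk_to_apath p"
    have q: "apath x ?q y" using apath_awalk_to_apath[OF p(1)] .
    have "set (pawalk_verts x ?q) \<subseteq> {x} \<union> snd ` set ?q"
      using q awalk_verts_conv'[of x ?q y] by (auto simp: apath_def awalk_def pcas_iff)
    also have "\<dots> \<subseteq> {x} \<union> snd ` set p" using awalk_to_apath_subset[OF p(1)] by blast
    finally have "(set (pawalk_verts x ?q) - {x, y}) \<inter> ({v} \<union> nbhd G v) = {}"
      using p(2) xyH by (auto simp: S_def nbhd_def pH)
    then show ?thesis using q by blast
  qed
  then show ?thesis using assms(3) unfolding avoidable_def simplicial_def
    by (auto simp: awalk_verts_with_proj_eq pH)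
qed

theorem theorem3p1:
  fixes G :: "'a pair_pre_digraph" and v :: 'a
  assumes "pair_graph G"
    and "v \<in> pverts G"
  shows "avoidable G v \<longleftrightarrow> (\<exists>H. minimal_triangulation G H \<and> simplicial H v)"
proof
  assume "avoidable G v"
  then show "\<exists>H. minimal_triangulation G H \<and> simplicial H v"
    using ex_minimal_triangulation_same_nbhd[OF assms]
      simplicial_triangulation_if_avoidable[OF assms(1)] by blast
next
  assume "\<exists>H. minimal_triangulation G H \<and> simplicial H v"
  then show "avoidable G v"
    using avoidable_if_simplicial_triangulation[OF assms(1)] by blast
qed

end
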